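(* Let $\lambda_0\ge 1$ be an integer, $\rho>1$ a real number, and $\lambda_k=\lceil\lambda_0\rho^k\rceil$ for $k\ge 0$. Let $\mathcal{L}^\times(\hat\lambda,\rho)$ be the loss function of this restart strategy, and let $$\mathcal{L}^\times_{\mathrm{up}}(\hat\lambda,\rho)=\hat\lambda\left(\rho+\frac{1}{\rho-1}\right)-\frac{\lambda_0}{\rho-1}+\frac{\ln(\hat\lambda/\lambda_0)}{\ln(\rho)}.$$ Then $\mathcal{L}^\times_{\mathrm{up}}(\hat\lambda,\rho)$ is an upper bound of $\mathcal{L}^\times(\hat\lambda,\rho)$, i.e. $\mathcal{L}^\times(\hat\lambda,\rho)\le\mathcal{L}^\times_{\mathrm{up}}(\hat\lambda,\rho)$ for all integers $\hat\lambda\ge\lambda_0$.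
   Context: For a restart strategy $(\lambda_0,\lambda_1,\lambda_2,\ldots)$ (an unbounded sequence of natural numbers) and an integer $\hat\lambda\ge\lambda_0$, let $\hat k(\hat\lambda)=\min\{k\ge 0:\lambda_k\ge\hat\lambda\}$. The loss function is $\mathcal{L}(\hat\lambda)=\sum_{k=0}^{\hat k(\hat\lambda)}\lambda_k-\hat\lambda$; it is denoted $\mathcal{L}^\times(\hat\lambda,\rho)$ for the strategy $\lambda_k=\lceil\lambda_0\rho^k\rceil$. *)

theory Defs
  imports Complex_Main
begin

definition restart_strategy :: "(nat \<Rightarrow> nat) \<Rightarrow> bool" where
  "restart_strategy lam \<longleftrightarrow> \<not> bdd_above (range lam)"

text \<open>The minimum below exists because a restart strategy is unbounded; on bounded sequences
  \<open>LEAST\<close> may be unspecified.\<close>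

definition khat :: "(nat \<Rightarrow> nat) \<Rightarrow> nat \<Rightarrow> nat" where
  "khat lam h = (LEAST k. lam k \<ge> h)"

definition loss :: "(nat \<Rightarrow> nat) \<Rightarrow> nat \<Rightarrow> int" where
  "loss lam h = (\<Sum>k=0..khat lam h. int (lam k)) - int h"

definition geometric_strategy :: "nat \<Rightarrow> real \<Rightarrow> nat \<Rightarrow> nat" where
  "geometric_strategy lam0 \<rho> k = nat \<lceil>real lam0 * \<rho> ^ k\<rceil>"

definition loss_mult :: "nat \<Rightarrow> nat \<Rightarrow> real \<Rightarrow> int" where
  "loss_mult lam0 h \<rho> = loss (geometric_strategy lam0 \<rho>) h"

definition loss_mult_up :: "nat \<Rightarrow> nat \<Rightarrow> real \<Rightarrow> real" where
  "loss_mult_up lam0 h \<rho> =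
     real h * (\<rho> + 1 / (\<rho> - 1)) - real lam0 / (\<rho> - 1) + ln (real h / real lam0) / ln \<rho>"

lemma khat_reaches:
  assumes "restart_strategy lam"
  shows "lam (khat lam h) \<ge> h"
proof -
  have "\<exists>k. lam k \<ge> h"
    using assms unfolding restart_strategy_def bdd_above_def by (metis imageE nat_le_linear)
  then show ?thesis
    unfolding khat_def by (rule LeastI_ex)
qed

lemma restart_strategy_geometric:
  assumes "lam0 \<ge> 1" and "\<rho> > 1"
  shows "restart_strategy (geometric_strategy lam0 \<rho>)"
  unfolding restart_strategy_def
proof
  assume "bdd_above (range (geometric_strategy lam0 \<rho>))"
  then obtain M where M: "\<And>k. geometric_strategy lam0 \<rho> k \<le> M"
    by (auto simp: bdd_above_def)
  obtain k where k: "real M < \<rho> ^ k"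
    using real_arch_pow[OF assms(2)] by blast
  have "1 * \<rho> ^ k \<le> real lam0 * \<rho> ^ k"
    using assms by (intro mult_right_mono) auto
  also have "\<dots> \<le> real (geometric_strategy lam0 \<rho> k)"
    unfolding geometric_strategy_def by (rule real_nat_ceiling_ge)
  also have "\<dots> \<le> real M"
    using M by simp
  finally show False
    using k by simp
qed

end

theory Submission
  imports Defs
begin

text \<open>If the threshold \<open>h\<close> is reached at index \<open>m + 1\<close>, minimality of the index gives
  \<open>\<lceil>\<lambda>\<^sub>0 \<rho>\<^sup>m\<rceil> < h\<close>, and since both sides are integers \<open>\<lambda>\<^sub>0 \<rho>\<^sup>m \<le> h - 1\<close>. Each rounding after the
  first costs at most \<open>1\<close>, so the loss is at most a geometric sum plus \<open>m + 1\<close>, where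
  \<open>m \<le> ln (h / \<lambda>\<^sub>0) / ln \<rho>\<close>. The unit gained by integrality, multiplied by \<open>\<rho>\<^sup>2 / (\<rho> - 1) \<ge> 1\<close>,
  absorbs the remaining \<open>1\<close>.\<close>

lemma geometric_strategy_0: "geometric_strategy lam0 \<rho> 0 = lam0"
  by (simp add: geometric_strategy_def)

lemma geometric_strategy_le:
  assumes "\<rho> > 1"
  shows "real (geometric_strategy lam0 \<rho> k) \<le> real lam0 * \<rho> ^ k + 1"
proof -
  \<comment> \<open>The sign ensures that \<open>nat\<close> does not truncate the ceiling.\<close>
  have "0 \<le> real lam0 * \<rho> ^ k" using assms by simp
  then show ?thesis unfolding geometric_strategy_def by linarith
qed

text \<open>The term at index 0 is an integer already, so only the \<open>n\<close> later terms
  contribute a rounding error.\<close>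

lemma sum_geometric_strategy_le:
  assumes "\<rho> > 1"
  shows "(\<Sum>k=0..n. real (geometric_strategy lam0 \<rho> k))
    \<le> real lam0 * (\<rho> ^ Suc n - 1) / (\<rho> - 1) + real n"
proof (induction n)
  case 0
  show ?case using assms by (simp add: geometric_strategy_0)
next
  case (Suc n)
  have "real lam0 * (\<rho> ^ Suc (Suc n) - 1) / (\<rho> - 1)
      = real lam0 * (\<rho> ^ Suc n - 1) / (\<rho> - 1) + real lam0 * \<rho> ^ Suc n"
    using assms by (simp add: field_simps)
  then show ?case
    using Suc geometric_strategy_le[OF assms, of lam0 "Suc n"] by simp
qed

lemma power_le_of_khat_geometric_strategy:
  assumes "khat (geometric_strategy lam0 \<rho>) h = Suc m"
  shows "real lam0 * \<rho> ^ m \<le> real h - 1"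
proof -
  have "geometric_strategy lam0 \<rho> m < h"
    using not_less_Least[of m "\<lambda>k. h \<le> geometric_strategy lam0 \<rho> k"] assms
    by (simp add: khat_def not_le)
  then show ?thesis
    using real_nat_ceiling_ge[of "real lam0 * \<rho> ^ m"]
    unfolding geometric_strategy_def by linarith
qed

text \<open>Taking logarithms turns the number of roundings into the logarithmic term of the
  bound.\<close>

lemma exponent_le_ln_div_ln:
  fixes a b r :: real
  assumes "a > 0" "r > 1" "a * r ^ m \<le> b"
  shows "real m \<le> ln (b / a) / ln r"
proof -
  have "r ^ m \<le> b / a" using assms by (simp add: field_simps)
  then have "ln (r ^ m) \<le> ln (b / a)"
    using assms by (intro ln_mono) (auto intro: less_le_trans[of 0 "r ^ m"])
  then show ?thesis using assms by (simp add: ln_realpow field_simps)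
qed

theorem theorem3:
  fixes lam0 :: nat and \<rho> :: real
  assumes "lam0 \<ge> 1" and "\<rho> > 1"
  shows "\<forall>h::nat. h \<ge> lam0 \<longrightarrow> real_of_int (loss_mult lam0 h \<rho>) \<le> loss_mult_up lam0 h \<rho>"
proof (intro allI impI)
  fix h :: nat
  assume h: "h \<ge> lam0"
  define K where "K = khat (geometric_strategy lam0 \<rho>) h"
  have loss: "real_of_int (loss_mult lam0 h \<rho>)
      = (\<Sum>k=0..K. real (geometric_strategy lam0 \<rho> k)) - real h"
    by (simp add: loss_mult_def loss_def K_def)
  show "real_of_int (loss_mult lam0 h \<rho>) \<le> loss_mult_up lam0 h \<rho>"
  proof (cases K)
    case 0
    \<comment> \<open>The first run already suffices: the loss is 0 and the logarithm
      vanishes.\<close>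
    then have "h \<le> lam0"
      using khat_reaches[OF restart_strategy_geometric[OF assms], of h]
      by (simp add: K_def geometric_strategy_0)
    with h have "h = lam0" by simp
    then have "loss_mult_up lam0 h \<rho> = real lam0 * \<rho>"
      using assms by (simp add: loss_mult_up_def distrib_left)
    with \<open>h = lam0\<close> show ?thesis
      using assms 0 loss by (simp add: geometric_strategy_0)
  next
    case (Suc m)
    have a: "real lam0 * \<rho> ^ m \<le> real h - 1"
      using power_le_of_khat_geometric_strategy Suc by (simp add: K_def)
    have log: "real m \<le> ln (real h / real lam0) / ln \<rho>"
      using exponent_le_ln_div_ln[of "real lam0" \<rho> m "real h"] a assms by simp
    \<comment> \<open>The summand 1 split off here yields the \<open>real h\<close> that cancels the
      \<open>- real h\<close> in the loss.\<close>
    have coeff: "\<rho>\<^sup>2 / (\<rho> - 1) = \<rho> + 1 + 1 / (\<rho> - 1)"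
      using assms by (simp add: field_simps power2_eq_square)
    have "real lam0 * (\<rho> ^ Suc K - 1) / (\<rho> - 1)
        = (real lam0 * \<rho> ^ m) * (\<rho>\<^sup>2 / (\<rho> - 1)) - real lam0 / (\<rho> - 1)"
      using Suc by (simp add: diff_divide_distrib right_diff_distrib power2_eq_square)
    also have "\<dots> \<le> (real h - 1) * (\<rho>\<^sup>2 / (\<rho> - 1)) - real lam0 / (\<rho> - 1)"
      using a assms by (intro diff_right_mono mult_right_mono) auto
    also have "\<dots> = real h * (\<rho> + 1 / (\<rho> - 1)) + real h - (\<rho> + 1 + 1 / (\<rho> - 1))
        - real lam0 / (\<rho> - 1)"
      unfolding coeff by (simp add: algebra_simps diff_divide_distrib)
    finally have "real_of_int (loss_mult lam0 h \<rho>)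
        \<le> real h * (\<rho> + 1 / (\<rho> - 1)) - (\<rho> + 1 + 1 / (\<rho> - 1)) - real lam0 / (\<rho> - 1) + real (Suc m)"
      using sum_geometric_strategy_le[OF assms(2), of lam0 K] loss Suc by simp
    \<comment> \<open>With this sign, \<open>\<rho> + 1 + 1 / (\<rho> - 1)\<close> exceeds 1, the
      gap between \<open>Suc m\<close> and the \<open>m\<close> bounded in
      \<open>log\<close>.\<close>
    moreover have "0 < 1 / (\<rho> - 1)" using assms by simp
    ultimately show ?thesis
      using log assms unfolding loss_mult_up_def by linarith
  qed
qed

end
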